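(* Let $f$ be a real-valued additive arithmetical function such that the two series $$\sum_{p} \frac{\min(1, f(p)^2)}{p}, \qquad \sum_{\substack{p \\ |f(p)| \leq 1}} \frac{f(p)}{p}$$ (over primes $p$) converge, and such that $$\sum_{f(p) \neq 0} \frac{1}{p} < \infty .$$ Let $u_f$, $S_p$, $w_p$, $\alpha_f$, $\beta_f$, $h_f$, $F$ and $F_x$ be as defined in the context. Then there is a constant $C$ (which may depend on $f$) such that for all $x \geq 3$, $$\sup_{y\in\mathbb{R}} |F_x(y)-F(y)| \leq C\left( \alpha_f\big(x^{1/\log_2 x}\big) + \beta_f(\sqrt{x})^{1/4} + \frac{1}{(\log x)^{1/6}}\right).$$
   Context: $p$ always denotes a prime. $f$ additive means $f(mn)=f(m)+f(n)$ whenever $(m,n)=1$. $\log_2 x = \log\log x$. Define the multiplicative function $u_f$ by $u_f(p^\nu) = 1$ if $f(p^\nu)\neq 0$ and $u_f(p^\nu)=0$ if $f(p^\nu)=0$ ($\nu\ge1$). For each prime $p$ put $S_p := \sum_{\nu\ge1} u_f(p^\nu)/p^\nu$ and $w_p := (1-1/p)S_p$. Put $\alpha_f(y) := \sum_{p>y} u_f(p)/p$ and $\beta_f(y) := \frac{1}{\log y}\int_1^y \frac{\alpha_f(t)}{t}\,dt$. Put $h_f(m) := u_f(m)\prod_{p\mid m} \frac{1-1/p}{1-w_p}$ for $m\ge1$, and $$F(y) := \prod_p (1-w_p) \sum_{\substack{m\ge1\\ f(m)\le y}} \frac{h_f(m)}{m} \quad (y\in\mathbb{R}),$$ which is a distribution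 function (the limiting distribution of $f$). For $x\ge1$, $F_x(y) := \frac{1}{x}\#\{n\le x : f(n)\le y\}$. *)

theory Defs
  imports "HOL-Analysis.Analysis" "HOL-Computational_Algebra.Primes"
begin

text \<open>Arithmetical functions are functions on \<^typ>\<open>nat\<close> whose value at 0 is irrelevant.\<close>

definition additive_arith :: "(nat \<Rightarrow> real) \<Rightarrow> bool" where
  "additive_arith f \<longleftrightarrow>
     (\<forall>m n. m \<ge> 1 \<longrightarrow> n \<ge> 1 \<longrightarrow> coprime m n \<longrightarrow> f (m * n) = f m + f n)"

text \<open>
  The multiplicative function that is 1 at a prime power \<open>p ^ \<nu>\<close> (\<open>\<nu> \<ge> 1\<close>) if \<open>f (p ^ \<nu>) \<noteq> 0\<close>,
  and 0 otherwise. It need not coincide with the indicator of \<open>f n \<noteq> 0\<close> at other \<open>n\<close>.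
\<close>
definition u_fun :: "(nat \<Rightarrow> real) \<Rightarrow> nat \<Rightarrow> real" where
  "u_fun f n = (\<Prod>p\<in>prime_factors n. if f (p ^ multiplicity p n) \<noteq> 0 then 1 else 0)"

definition S_fun :: "(nat \<Rightarrow> real) \<Rightarrow> nat \<Rightarrow> real" where
  "S_fun f p = (\<Sum>\<^sub>\<infinity>\<nu>\<in>{1..}. u_fun f (p ^ \<nu>) / real p ^ \<nu>)"

definition w_fun :: "(nat \<Rightarrow> real) \<Rightarrow> nat \<Rightarrow> real" where
  "w_fun f p = (1 - 1 / real p) * S_fun f p"

definition alpha_fun :: "(nat \<Rightarrow> real) \<Rightarrow> real \<Rightarrow> real" where
  "alpha_fun f y = (\<Sum>\<^sub>\<infinity>p\<in>{p. prime p \<and> real p > y}. u_fun f p / real p)"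

definition beta_fun :: "(nat \<Rightarrow> real) \<Rightarrow> real \<Rightarrow> real" where
  "beta_fun f y = 1 / ln y * integral {1..y} (\<lambda>t. alpha_fun f t / t)"

definition h_fun :: "(nat \<Rightarrow> real) \<Rightarrow> nat \<Rightarrow> real" where
  "h_fun f m = u_fun f m * (\<Prod>p\<in>prime_factors m. (1 - 1 / real p) / (1 - w_fun f p))"

definition limit_distr :: "(nat \<Rightarrow> real) \<Rightarrow> real \<Rightarrow> real" where
  "limit_distr f y =
     (\<Prod>p. if prime p then 1 - w_fun f p else 1) *
     (\<Sum>\<^sub>\<infinity>m\<in>{m. m \<ge> 1 \<and> f m \<le> y}. h_fun f m / real m)"

definition empirical_distr :: "(nat \<Rightarrow> real) \<Rightarrow> real \<Rightarrow> real \<Rightarrow> real" where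
  "empirical_distr f x y = 1 / x * real (card {n. n \<ge> 1 \<and> real n \<le> x \<and> f n \<le> y})"

lemma u_fun_prime_power:
  assumes "prime p" "\<nu> \<ge> 1"
  shows "u_fun f (p ^ \<nu>) = (if f (p ^ \<nu>) \<noteq> 0 then 1 else 0)"
  using assms by (simp add: u_fun_def prime_factorization_prime_power)

lemma u_fun_mult:
  assumes "m \<ge> 1" "n \<ge> 1" "coprime m n"
  shows "u_fun f (m * n) = u_fun f m * u_fun f n"
proof -
  have disj: "prime_factors m \<inter> prime_factors n = {}"
  proof (rule equals0I)
    fix p assume p: "p \<in> prime_factors m \<inter> prime_factors n"
    then have "p dvd m" "p dvd n" "prime p" by auto
    with assms(3) show False
      using coprime_common_divisor not_prime_unit by blast
  qed
  have 1: "multiplicity p (m * n) = multiplicity p m" if "p \<in> prime_factors m" for p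
  proof -
    have "\<not> p dvd n" using that disj assms by (auto simp: in_prime_factors_iff)
    then show ?thesis using that assms
      by (simp add: prime_elem_multiplicity_mult_distrib in_prime_factors_iff
          not_dvd_imp_multiplicity_0)
  qed
  have 2: "multiplicity p (m * n) = multiplicity p n" if "p \<in> prime_factors n" for p
  proof -
    have "\<not> p dvd m" using that disj assms by (auto simp: in_prime_factors_iff)
    then show ?thesis using that assms
      by (simp add: prime_elem_multiplicity_mult_distrib in_prime_factors_iff
          not_dvd_imp_multiplicity_0)
  qed
  have "prime_factors (m * n) = prime_factors m \<union> prime_factors n"
    using assms by (intro prime_factors_product) auto
  then show ?thesis
    using disj 1 2 by (simp add: u_fun_def prod.union_disjoint)
qed

end

theory Submission imports Defs "HOL-Real_Asymp.Real_Asymp" begin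

text \<open>
  The part \<open>f\<^sub>T n = (\<Sum>p\<in>T. f (p ^ \<nu>\<^sub>p n))\<close> of \<open>f\<close> living on a finite set \<open>T\<close> of primes has a limiting
  distribution \<open>model T\<close>. Adding a prime \<open>p\<close> to \<open>T\<close> expresses the new counting function through the
  old one at \<open>x / p ^ k\<close> and \<open>x / p ^ (k + 1)\<close>, and induction on \<open>T\<close> gives the Rankin type error bound
  \<open>x powr (1 - \<delta>) * (\<Prod>p\<in>T. (1 + s\<^sub>p) / (1 - s\<^sub>p))\<close> with \<open>s\<^sub>p = p powr (\<delta> - 1)\<close>. Passing from \<open>T\<close> to all
  primes changes \<open>f\<close> on a set of density at most \<open>\<Sum>p\<notin>T. u p / p + 1 / p\<^sup>2\<close>; letting \<open>T\<close> grow also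
  identifies the limit of the models with \<open>F\<close>.

  With \<open>y = x powr (1 / ln (ln x))\<close>, \<open>w = (ln x) powr (1 / 6)\<close> and \<open>\<delta> = 3 / ln y\<close>, the theorem follows
  by taking for \<open>T\<close> the primes \<open>p \<le> y\<close> with \<open>f p \<noteq> 0\<close> and all primes \<open>p \<le> w\<close>. Since \<open>\<Sum>1 / p\<close> over
  \<open>f p \<noteq> 0\<close> converges, the product over the former is bounded, so that the total error is
  \<open>O(\<alpha> y + 1 / w)\<close>.
\<close>

section \<open>Elementary estimates for integers, sums and products\<close>

lemma multiplicity_power_mult_other:
  assumes "prime p" "prime q" "p \<noteq> q" "n \<ge> (1::nat)"
  shows "multiplicity q (p ^ k * n) = multiplicity q n"
  using assms by (simp add: prime_elem_multiplicity_mult_distrib multiplicity_distinct_prime_power)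

lemma multiplicity_less_self:
  assumes "prime p" "n \<ge> (1::nat)"
  shows "multiplicity p n < n"
proof -
  have "Suc 0 < p" using prime_gt_1_nat[OF assms(1)] by simp
  have "p ^ multiplicity p n \<le> n"
    using assms by (intro dvd_imp_le multiplicity_dvd) auto
  moreover have "multiplicity p n < p ^ multiplicity p n"
    using \<open>Suc 0 < p\<close> by (rule power_gt_expt)
  ultimately show ?thesis by linarith
qed

text \<open>This feeds the base case of the induction on \<open>T\<close>. Arguments below 1 have to
  be covered because the induction evaluates the bound at \<open>x / p ^ k\<close> for every
  \<open>k\<close>; there the floor is 0 and \<open>x \<le> x powr (1 - \<delta>)\<close>.\<close>

lemma floor_approx_le_powr:
  fixes x \<delta> :: real
  assumes "0 < x" "0 \<le> \<delta>" "\<delta> \<le> 1"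
  shows "\<bar>real (nat \<lfloor>x\<rfloor>) - x\<bar> \<le> x powr (1 - \<delta>)"
proof (cases "x \<ge> 1")
  case True
  have "\<bar>real (nat \<lfloor>x\<rfloor>) - x\<bar> \<le> 1" using True by linarith
  also have "1 \<le> x powr (1 - \<delta>)" using True assms by (simp add: ge_one_powr_ge_zero)
  finally show ?thesis .
next
  case False
  have "\<lfloor>x\<rfloor> = 0" using False assms by (simp add: floor_eq_iff)
  then have "\<bar>real (nat \<lfloor>x\<rfloor>) - x\<bar> = x powr 1" using assms by simp
  also have "\<dots> \<le> x powr (1 - \<delta>)" using False assms by (intro powr_mono') auto
  finally show ?thesis .
qed

lemma card_multiples_le:
  assumes "d \<ge> (1::nat)" "x \<ge> (0::real)"
  shows "finite {n. n \<ge> 1 \<and> real n \<le> x \<and> d dvd n}"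
    and "real (card {n. n \<ge> 1 \<and> real n \<le> x \<and> d dvd n}) \<le> x / real d"
proof -
  have eq: "{n. n \<ge> 1 \<and> real n \<le> x \<and> d dvd n} = (\<lambda>k. d * k) ` {1..nat \<lfloor>x / real d\<rfloor>}"
  proof (intro equalityI subsetI)
    fix n assume "n \<in> {n. n \<ge> 1 \<and> real n \<le> x \<and> d dvd n}"
    then obtain k where k: "n = d * k" "n \<ge> 1" "real n \<le> x" by auto
    then have "real k \<le> x / real d" using assms by (simp add: field_simps)
    then show "n \<in> (\<lambda>k. d * k) ` {1..nat \<lfloor>x / real d\<rfloor>}"
      using k by (auto simp: le_nat_floor Suc_le_eq intro!: image_eqI[of _ _ k])
  next
    fix n assume "n \<in> (\<lambda>k. d * k) ` {1..nat \<lfloor>x / real d\<rfloor>}"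
    then obtain k where k: "n = d * k" "1 \<le> k" "k \<le> nat \<lfloor>x / real d\<rfloor>"
      unfolding image_iff Bex_def atLeastAtMost_iff by blast
    then have "real k \<le> x / real d" using assms by (simp add: le_nat_iff le_floor_iff)
    then show "n \<in> {n. n \<ge> 1 \<and> real n \<le> x \<and> d dvd n}"
      using k assms by (auto simp: field_simps)
  qed
  show "finite {n. n \<ge> 1 \<and> real n \<le> x \<and> d dvd n}" unfolding eq by simp
  have "real (card {n. n \<ge> 1 \<and> real n \<le> x \<and> d dvd n}) = real (nat \<lfloor>x / real d\<rfloor>)"
    unfolding eq using assms by (subst card_image) (auto simp: inj_on_def)
  also have "\<dots> \<le> x / real d" using assms by simp
  finally show "real (card {n. n \<ge> 1 \<and> real n \<le> x \<and> d dvd n}) \<le> x / real d" .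
qed

lemma finite_pos_nat_le_real: "finite {n::nat. n \<ge> 1 \<and> real n \<le> x \<and> P n}"
  by (rule finite_subset[OF _ finite_atMost[of "nat \<lfloor>x\<rfloor>"]]) (auto simp: le_nat_floor)

text \<open>Telescoping with 1 / (n + 1)^2 \<le> 1 / n - 1 / (n + 1), started at the floor
  \<open>k\<close> of \<open>w\<close>, gives 1 / k. The factor 2 comes from w < k + 1 \<le> 2
  k.\<close>

lemma sum_inverse_squares_le:
  fixes w :: real
  assumes "w \<ge> 1" "finite F" "\<And>n. n \<in> F \<Longrightarrow> real n > w"
  shows "(\<Sum>n\<in>F. 1 / real n ^ 2) \<le> 2 / w"
proof -
  define k where "k = nat \<lfloor>w\<rfloor>"
  define N where "N = Max (insert k F)"
  have k: "k \<ge> 1" "real k \<le> w" "w < real k + 1"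
    using assms(1) by (auto simp: k_def le_nat_iff le_floor_iff)
  have tele: "(\<Sum>n\<in>{k<..N}. 1 / real n ^ 2) \<le> 1 / real k - 1 / real N" if "k \<le> N" for N
    using that
  proof (induction N rule: dec_induct)
    case (step N)
    then have N: "real N > 0" using k by linarith
    have "{k<..Suc N} = insert (Suc N) {k<..N}" using step by auto
    then have "(\<Sum>n\<in>{k<..Suc N}. 1 / real n ^ 2) \<le> 1 / real (Suc N) ^ 2 + (1 / real k - 1 / real N)"
      using step by simp
    also have "1 / real (Suc N) ^ 2 \<le> 1 / (real N * real (Suc N))"
      unfolding power2_eq_square using N by (intro divide_left_mono mult_right_mono mult_pos_pos) auto
    also have "\<dots> = 1 / real N - 1 / real (Suc N)"
      using N by (simp add: field_simps)
    finally show ?case by simp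
  qed auto
  have "F \<subseteq> {k<..N}"
  proof
    fix n assume n: "n \<in> F"
    then have "real k < real n" using assms(3)[OF n] k by linarith
    then show "n \<in> {k<..N}" using n assms(2) by (simp add: N_def)
  qed
  then have "(\<Sum>n\<in>F. 1 / real n ^ 2) \<le> (\<Sum>n\<in>{k<..N}. 1 / real n ^ 2)"
    by (intro sum_mono2) auto
  also have "\<dots> \<le> 1 / real k - 1 / real N"
    using assms(2) by (intro tele) (simp add: N_def)
  also have "\<dots> \<le> 1 / real k" by simp
  also have "\<dots> \<le> 2 / w"
  proof -
    have "real k \<ge> 1" using k by simp
    moreover from this have "w \<le> 2 * real k" using k by linarith
    ultimately show ?thesis using assms(1) by (simp add: divide_le_eq field_simps)
  qed
  finally show ?thesis .
qed

lemma sum_inverse_le_ln: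
  fixes w :: real
  assumes "w \<ge> 1" "\<And>n. n \<in> F \<Longrightarrow> n \<ge> 1 \<and> real n \<le> w"
  shows "(\<Sum>n\<in>F. 1 / real n) \<le> 1 + ln w"
proof -
  define k where "k = nat \<lfloor>w\<rfloor>"
  have k: "k \<ge> 1" "real k \<le> w" using assms(1) by (auto simp: k_def le_nat_iff le_floor_iff)
  have "F \<subseteq> {1..k}" using assms(2) by (auto simp: k_def le_nat_floor)
  then have "(\<Sum>n\<in>F. 1 / real n) \<le> (\<Sum>n\<in>{1..k}. 1 / real n)"
    by (intro sum_mono2) auto
  also have "\<dots> = harm k" by (simp add: harm_def divide_inverse)
  \<comment> \<open>The sequence \<open>harm n - ln n\<close> decreases from its value 1 at
    \<open>n = 1\<close>.\<close>
  also have "\<dots> \<le> 1 + ln (real k)"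
    using euler_mascheroni_sequence_decreasing[of 1 k] k by (simp add: harm_def)
  also have "ln (real k) \<le> ln w" using k by simp
  finally show ?thesis by simp
qed

text \<open>Primes are at least 2, so for \<delta> \<le> 1/4 this keeps
  \<open>p powr (\<delta> - 1)\<close> away from 1. Taking fourth powers reduces it to 1/8 \<le>
  16/81.\<close>

lemma two_powr_le: "2 powr (- 3 / 4 :: real) \<le> 2 / 3"
proof -
  have "(2 powr (- 3 / 4 :: real)) ^ 4 = 2 powr (- 3)"
    by (simp add: powr_power)
  also have "\<dots> = 1 / 8" by (simp add: powr_minus)
  also have "\<dots> \<le> (2 / 3) ^ 4" by (simp add: power4_eq_xxxx)
  finally show ?thesis by (rule power_le_imp_le_base[of _ 3, simplified]) simp
qed

lemma prod_le_exp_sum: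
  assumes "finite T" "\<And>q. q \<in> T \<Longrightarrow> prime q" "\<delta> \<le> 1 / 4"
  shows "(\<Prod>p\<in>T. (1 + real p powr (\<delta> - 1)) / (1 - real p powr (\<delta> - 1)))
           \<le> exp (6 * (\<Sum>p\<in>T. real p powr (\<delta> - 1)))"
proof -
  have "0 \<le> (1 + s) / (1 - s) \<and> (1 + s) / (1 - s) \<le> exp (6 * s)"
    if p: "p \<in> T" and s: "s = real p powr (\<delta> - 1)" for p s
  proof -
    have "s \<le> real p powr (- 3 / 4)"
      unfolding s using assms(2)[OF p] assms(3) prime_gt_1_nat[of p] by (intro powr_mono) auto
    also have "\<dots> \<le> 2 powr (- 3 / 4)"
      using assms(2)[OF p] prime_ge_2_nat[of p] by (intro powr_mono2') auto
    also note two_powr_le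
    finally have s23: "s \<le> 2 / 3" .
    have s0: "s \<ge> 0" by (simp add: s)
    have "s * s \<le> 2 / 3 * s" using s0 s23 by (intro mult_right_mono)
    \<comment> \<open>Since 1 - s \<ge> 1/3, the quotient 1 + 2 s / (1 - s) is at most 1 + 6 s; this
      is the origin of the constant 6.\<close>
    then have "(1 + s) / (1 - s) \<le> 1 + 6 * s" using s23 by (simp add: field_simps)
    also have "\<dots> \<le> exp (6 * s)" by (rule exp_ge_add_one_self)
    finally show ?thesis using s0 s23 by simp
  qed
  then have "(\<Prod>p\<in>T. (1 + real p powr (\<delta> - 1)) / (1 - real p powr (\<delta> - 1)))
      \<le> (\<Prod>p\<in>T. exp (6 * real p powr (\<delta> - 1)))"
    by (intro prod_mono) auto
  also have "\<dots> = exp (6 * (\<Sum>p\<in>T. real p powr (\<delta> - 1)))"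
    using assms(1) by (simp add: exp_sum sum_distrib_left)
  finally show ?thesis .
qed

section \<open>The part of \<open>f\<close> carried by a finite set of primes\<close>

locale additive_function =
  fixes f :: "nat \<Rightarrow> real"
  assumes additive: "additive_arith f"
begin

text \<open>Primes of \<open>T\<close> not dividing \<open>n\<close> contribute
  \<open>f 1 = 0\<close>, so \<open>T\<close> itself can serve as index set, and adjoining a prime
  adds exactly one summand.\<close>

definition partial_f :: "nat set \<Rightarrow> nat \<Rightarrow> real" where
  "partial_f T n = (\<Sum>p\<in>T. f (p ^ multiplicity p n))"

definition partial_count :: "nat set \<Rightarrow> real \<Rightarrow> real \<Rightarrow> real" where
  "partial_count T x t = real (card {n. n \<ge> 1 \<and> real n \<le> x \<and> partial_f T n \<le> t})"

definition smooth :: "nat set \<Rightarrow> nat set" where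
  "smooth T = {m. m \<ge> 1 \<and> prime_factors m \<subseteq> T}"

definition h_weight :: "nat \<Rightarrow> real" where
  "h_weight m = h_fun f m / real m"

text \<open>This is \<open>limit_distr\<close> with the Euler product and the range of
  \<open>m\<close> both cut down to \<open>T\<close>.\<close>

definition model :: "nat set \<Rightarrow> real \<Rightarrow> real" where
  "model T t = (\<Prod>p\<in>T. 1 - w_fun f p) * infsum h_weight {m \<in> smooth T. f m \<le> t}"

lemma f_mult: "m \<ge> 1 \<Longrightarrow> n \<ge> 1 \<Longrightarrow> coprime m n \<Longrightarrow> f (m * n) = f m + f n"
  using additive by (auto simp: additive_arith_def)

lemma f_1 [simp]: "f 1 = 0" "f (Suc 0) = 0"
  using f_mult[of 1 1] by auto

lemma partial_f_power_mult:
  assumes "prime p" "p \<notin> T" "\<And>q. q \<in> T \<Longrightarrow> prime q" "n \<ge> 1"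
  shows "partial_f T (p ^ k * n) = partial_f T n"
  unfolding partial_f_def using assms
  by (intro sum.cong refl) (metis multiplicity_power_mult_other)

lemma f_eq_sum: "n \<ge> 1 \<Longrightarrow> f n = (\<Sum>p\<in>prime_factors n. f (p ^ multiplicity p n))"
proof -
  assume n: "n \<ge> 1"
  have "f (\<Prod>p\<in>A. p ^ multiplicity p n) = (\<Sum>p\<in>A. f (p ^ multiplicity p n))"
    if "finite A" "\<And>p. p \<in> A \<Longrightarrow> prime p" for A
    using that
  proof (induction A rule: finite_induct)
    case (insert p A)
    have "coprime (p ^ multiplicity p n) (\<Prod>p\<in>A. p ^ multiplicity p n)"
      using insert by (intro prod_coprime_right) (auto intro!: primes_coprime)
    moreover have "(\<Prod>p\<in>A. p ^ multiplicity p n) \<ge> 1"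
      using insert by (intro prod_ge_1) (auto simp: Suc_le_eq prime_gt_0_nat)
    ultimately show ?case using insert
      by (subst prod.insert) (auto simp: f_mult Suc_le_eq prime_gt_0_nat)
  qed auto
  from this[of "prime_factors n"] show ?thesis
    using n prod_prime_factors[of n] by (simp add: in_prime_factors_imp_prime)
qed

lemma partial_f_eq_f:
  assumes "n \<ge> 1" "prime_factors n \<subseteq> T" "finite T" "\<And>q. q \<in> T \<Longrightarrow> prime q"
  shows "partial_f T n = f n"
proof -
  have "partial_f T n = (\<Sum>p\<in>prime_factors n. f (p ^ multiplicity p n))"
    unfolding partial_f_def
  proof (intro sum.mono_neutral_right assms ballI)
    fix p assume p: "p \<in> T - prime_factors n"
    then have "multiplicity p n = 0"
      using assms by (auto simp: in_prime_factors_iff not_dvd_imp_multiplicity_0)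
    then show "f (p ^ multiplicity p n) = 0" by simp
  qed
  then show ?thesis using f_eq_sum assms(1) by simp
qed

lemma u_1 [simp]: "u_fun f 1 = 1" "u_fun f (Suc 0) = 1"
  by (simp_all add: u_fun_def)

lemma u_nonneg: "u_fun f n \<ge> 0"
  unfolding u_fun_def by (intro prod_nonneg) auto

lemma u_le_1: "u_fun f n \<le> 1"
  unfolding u_fun_def by (intro prod_le_1) auto

lemma u_prime: "prime p \<Longrightarrow> u_fun f p = (if f p \<noteq> 0 then 1 else 0)"
  using u_fun_prime_power[of p 1] by simp

section \<open>Local factors at a single prime\<close>

context
  fixes p :: nat assumes p: "prime p"
begin

lemma geometric_inverse_prime: "(\<lambda>k. 1 / real p ^ k) sums (1 / (1 - 1 / real p))"
  using geometric_sums[of "1 / real p"] prime_gt_1_nat[OF p] by (simp add: power_divide)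

text \<open>Filling the position \<open>k = 0\<close> with 0 turns the \<open>infsum\<close> over
  \<open>{1..}\<close> into a series that can be combined termwise with the geometric
  series.\<close>

lemma S_sums: "(\<lambda>k. if k = 0 then 0 else u_fun f (p ^ k) / real p ^ k) sums S_fun f p"
proof -
  let ?v = "\<lambda>k. if k = 0 then 0 else u_fun f (p ^ k) / real p ^ k"
  have "summable ?v"
  proof (rule summable_comparison_test'[of "\<lambda>k. 1 / real p ^ k" 0])
    show "summable (\<lambda>k. 1 / real p ^ k)" using geometric_inverse_prime by (rule sums_summable)
    show "norm (?v k) \<le> 1 / real p ^ k" if "k \<ge> 0" for k
      using u_nonneg[of "p ^ k"] u_le_1[of "p ^ k"] by (auto intro: divide_right_mono)
  qed
  then have "?v summable_on UNIV"
    by (subst summable_on_UNIV_nonneg_real_iff) (auto simp: u_nonneg)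
  then have "?v sums infsum ?v UNIV" by (intro has_sum_imp_sums has_sum_infsum)
  also have "infsum ?v UNIV = S_fun f p"
    unfolding S_fun_def by (rule infsum_cong_neutral) auto
  finally show ?thesis .
qed

lemma S_nonneg: "S_fun f p \<ge> 0"
  unfolding S_fun_def by (intro infsum_nonneg) (simp add: u_nonneg)

text \<open>Compare with the full geometric series, from which the term at \<open>k = 0\<close> is
  removed and the term at \<open>k = 1\<close> is corrected from 1 / p to its exact value u(p) /
  p.\<close>

lemma S_bound: "S_fun f p \<le> 1 / (1 - 1 / real p) - 1 - (1 - u_fun f p) / real p"
proof -
  let ?r = "\<lambda>k. 1 / real p ^ k - (if k = 0 then 1 else 0)
      - (if k = 1 then (1 - u_fun f p) / real p else 0)"
  have r: "?r sums (1 / (1 - 1 / real p) - 1 - (1 - u_fun f p) / real p)"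
    by (intro sums_diff geometric_inverse_prime sums_single)
  show ?thesis
    using u_le_1
    by (intro sums_le[OF _ S_sums r]) (auto simp: divide_simps u_nonneg)
qed

lemma w_nonneg: "w_fun f p \<ge> 0"
  unfolding w_fun_def using S_nonneg prime_gt_1_nat[OF p] by simp

text \<open>After multiplication by 1 - 1 / p the previous bound becomes u(p) / p + (1 - u(p)) /
  p^2. So \<open>w_fun f\<close> is summable over the primes as soon as \<Sum> 1 / p over f(p)
  \<noteq> 0 converges.\<close>

lemma w_bound: "w_fun f p \<le> u_fun f p / real p + 1 / real p ^ 2"
proof -
  have p1: "real p > 1" using prime_gt_1_nat[OF p] by simp
  have "w_fun f p \<le> (1 - 1 / real p) * (1 / (1 - 1 / real p) - 1 - (1 - u_fun f p) / real p)"
    unfolding w_fun_def using S_bound p1 by (intro mult_left_mono) auto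
  also have "\<dots> = u_fun f p / real p + (1 - u_fun f p) / real p ^ 2"
    using p1 by (simp add: field_simps power2_eq_square)
  also have "\<dots> \<le> u_fun f p / real p + 1 / real p ^ 2"
    using u_nonneg[of p] by (intro add_left_mono divide_right_mono) auto
  finally show ?thesis .
qed

lemma w_le: "w_fun f p \<le> 1 / real p"
proof -
  have p1: "real p > 1" using prime_gt_1_nat[OF p] by simp
  have "S_fun f p \<le> 1 / (1 - 1 / real p) - 1"
    using S_bound u_le_1[of p] by (smt (verit) divide_nonneg_nonneg of_nat_0_le_iff)
  then have "w_fun f p \<le> (1 - 1 / real p) * (1 / (1 - 1 / real p) - 1)"
    unfolding w_fun_def using p1 by (intro mult_left_mono) auto
  also have "\<dots> = 1 / real p" using p1 by (simp add: field_simps)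
  finally show ?thesis .
qed

lemma one_minus_w: "1 - w_fun f p \<ge> 1 / 2" "1 - w_fun f p \<le> 1"
proof -
  have "1 / real p \<le> 1 / 2" using prime_ge_2_nat[OF p] by (intro divide_left_mono) auto
  then show "1 - w_fun f p \<ge> 1 / 2" "1 - w_fun f p \<le> 1" using w_le w_nonneg by linarith+
qed

text \<open>The factor 1 - w cancels the denominator in \<open>h_fun\<close>. What remains is the
  density of the integers with exact exponent \<open>k\<close> at \<open>p\<close>, kept only if
  f(p^k) \<noteq> 0.\<close>

lemma h_weight_prime_power:
  assumes "k \<ge> 1"
  shows "(1 - w_fun f p) * h_weight (p ^ k) = u_fun f (p ^ k) / real p ^ k * (1 - 1 / real p)"
proof -
  have "prime_factors (p ^ k) = {p}"
    using p assms by (simp add: prime_factorization_prime_power)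
  then show ?thesis
    using one_minus_w by (simp add: h_weight_def h_fun_def)
qed

end

lemma h_weight_1 [simp]: "h_weight 1 = 1" "h_weight (Suc 0) = 1"
  by (simp_all add: h_weight_def h_fun_def)

lemma h_weight_nonneg: "h_weight m \<ge> 0"
proof -
  have "(1 - 1 / real p) / (1 - w_fun f p) \<ge> 0" if "p \<in> prime_factors m" for p
  proof -
    have "prime p" using that by auto
    then show ?thesis using one_minus_w[of p] prime_gt_1_nat[of p] by simp
  qed
  then have "(\<Prod>p\<in>prime_factors m. (1 - 1 / real p) / (1 - w_fun f p)) \<ge> 0"
    by (intro prod_nonneg) blast
  then show ?thesis unfolding h_weight_def h_fun_def
    by (intro divide_nonneg_nonneg mult_nonneg_nonneg u_nonneg) auto
qed

lemma h_weight_mult: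
  assumes "m \<ge> 1" "n \<ge> 1" "coprime m n"
  shows "h_weight (m * n) = h_weight m * h_weight n"
proof -
  have disj: "prime_factors m \<inter> prime_factors n = {}"
  proof (rule equals0I)
    fix p assume p: "p \<in> prime_factors m \<inter> prime_factors n"
    then have "p dvd m" "p dvd n" "prime p" by auto
    with assms(3) show False
      using coprime_common_divisor not_prime_unit by blast
  qed
  have "prime_factors (m * n) = prime_factors m \<union> prime_factors n"
    using assms by (intro prime_factors_product) auto
  with disj show ?thesis using assms
    by (simp add: h_weight_def h_fun_def u_fun_mult prod.union_disjoint)
qed

lemma h_weight_prime_power_le:
  assumes "prime p"
  shows "h_weight (p ^ k) \<le> 2 * (1 / real p ^ k)"
proof (cases "k \<ge> 1")
  case True
  have p1: "real p > 1" using prime_gt_1_nat[OF assms] by simp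
  have "1 / 2 * h_weight (p ^ k) \<le> (1 - w_fun f p) * h_weight (p ^ k)"
    by (intro mult_right_mono one_minus_w assms h_weight_nonneg)
  also have "\<dots> = u_fun f (p ^ k) / real p ^ k * (1 - 1 / real p)"
    by (rule h_weight_prime_power[OF assms True])
  also have "\<dots> \<le> 1 / real p ^ k * 1"
    using p1 u_le_1 by (intro mult_mono divide_right_mono) (auto simp: u_nonneg)
  finally show ?thesis by simp
qed (auto simp: not_le)

section \<open>Sums of \<open>h_weight\<close> over integers composed of primes in
  \<open>T\<close>\<close>

text \<open>Each integer is uniquely p^k m with \<open>m\<close> free of \<open>p\<close>. The
  predicate \<open>Q\<close> is left open: the trivial one serves for summability, a bound on
  \<open>f\<close> for the recursion.\<close>

lemma bij_betw_smooth_insert: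
  assumes p: "prime p" "p \<notin> T"
  shows "bij_betw (\<lambda>(k, m). p ^ k * m) (Sigma UNIV (\<lambda>k. {m \<in> smooth T. Q (p ^ k * m)}))
           {m \<in> smooth (insert p T). Q m}"
proof (rule bij_betwI[where g = "\<lambda>n. (multiplicity p n, n div p ^ multiplicity p n)"])
  have ndvd: "\<not> p dvd m" if "m \<in> smooth T" for m
    using that p by (auto simp: smooth_def in_prime_factors_iff)
  show "(\<lambda>(k, m). p ^ k * m) \<in> Sigma UNIV (\<lambda>k. {m \<in> smooth T. Q (p ^ k * m)}) \<rightarrow>
           {m \<in> smooth (insert p T). Q m}"
    using p by (auto simp: smooth_def prime_factors_product prime_factorization_prime_power
        Suc_le_eq prime_gt_0_nat split: if_splits)
  show "(\<lambda>n. (multiplicity p n, n div p ^ multiplicity p n)) \<in> {m \<in> smooth (insert p T). Q m}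
      \<rightarrow> Sigma UNIV (\<lambda>k. {m \<in> smooth T. Q (p ^ k * m)})"
  proof
    fix n assume n: "n \<in> {m \<in> smooth (insert p T). Q m}"
    then have n1: "n \<ge> 1" "prime_factors n \<subseteq> insert p T" "Q n" by (auto simp: smooth_def)
    define m where "m = n div p ^ multiplicity p n"
    have eq: "n = p ^ multiplicity p n * m" unfolding m_def by (simp add: multiplicity_dvd)
    have "m \<ge> 1" using eq n1 by (cases m) auto
    moreover have "\<not> p dvd m" unfolding m_def
      using n1 p by (intro multiplicity_decompose) auto
    moreover have "prime_factors m \<subseteq> prime_factors n"
      using eq n1 by (intro dvd_prime_factors) (auto intro: dvdI[of _ _ "p ^ multiplicity p n"] simp: mult.commute)
    ultimately show "(multiplicity p n, n div p ^ multiplicity p n)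
        \<in> Sigma UNIV (\<lambda>k. {m \<in> smooth T. Q (p ^ k * m)})"
      using n1 eq unfolding m_def[symmetric] by (auto simp: smooth_def)
  qed
  fix x assume "x \<in> Sigma UNIV (\<lambda>k. {m \<in> smooth T. Q (p ^ k * m)})"
  then obtain k m where x: "x = (k, m)" "m \<in> smooth T" by auto
  have "multiplicity p (p ^ k * m) = k"
    using x ndvd[of m] p by (intro multiplicity_eqI) (auto simp: smooth_def)
  then show "(\<lambda>n. (multiplicity p n, n div p ^ multiplicity p n)) ((\<lambda>(k, m). p ^ k * m) x) = x"
    using x p by simp
next
  fix n assume n: "n \<in> {m \<in> smooth (insert p T). Q m}"
  then show "(\<lambda>(k, m). p ^ k * m) ((\<lambda>n. (multiplicity p n, n div p ^ multiplicity p n)) n) = n"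
    by (simp add: multiplicity_dvd)
qed

lemma h_weight_prime_power_mult:
  assumes "prime p" "p \<notin> T" "m \<in> smooth T"
  shows "h_weight (p ^ k * m) = h_weight (p ^ k) * h_weight m"
    and "f (p ^ k * m) = f (p ^ k) + f m"
proof -
  have "\<not> p dvd m" using assms by (auto simp: smooth_def in_prime_factors_iff)
  then have c: "coprime (p ^ k) m" using assms(1) by (simp add: prime_imp_coprime)
  show "h_weight (p ^ k * m) = h_weight (p ^ k) * h_weight m"
    "f (p ^ k * m) = f (p ^ k) + f m"
    using assms c by (auto intro!: h_weight_mult f_mult simp: smooth_def Suc_le_eq prime_gt_0_nat)
qed

lemma smooth_empty: "smooth {} = {1}"
  by (auto simp: smooth_def prime_factorization_empty_iff)

lemma h_weight_summable_smooth:
  assumes "finite T" "\<And>q. q \<in> T \<Longrightarrow> prime q"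
  shows "h_weight summable_on smooth T"
  using assms
proof (induction T rule: finite_induct)
  case empty
  then show ?case by (simp add: smooth_empty)
next
  case (insert p T)
  then have p: "prime p" "p \<notin> T" and IH: "h_weight summable_on smooth T" by auto
  let ?A = "Sigma (UNIV :: nat set) (\<lambda>_. smooth T)"
  have "(\<lambda>k. h_weight (p ^ k)) summable_on UNIV"
  proof (subst summable_on_UNIV_nonneg_real_iff)
    show "summable (\<lambda>k. h_weight (p ^ k))"
    proof (rule summable_comparison_test'[of "\<lambda>k. 2 * (1 / real p ^ k)" 0])
      show "summable (\<lambda>k. 2 * (1 / real p ^ k))"
        using geometric_inverse_prime[OF p(1)] by (intro summable_mult sums_summable)
    qed (use h_weight_nonneg h_weight_prime_power_le[OF p(1)] in auto)
  qed (rule h_weight_nonneg)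
  \<comment> \<open>The double family is a product of a geometrically bounded sequence in
    \<open>k\<close> and the family given by the induction hypothesis.\<close>
  then have "(\<lambda>(k, m). h_weight (p ^ k) * h_weight m) summable_on ?A"
    by (intro summable_on_SigmaI[where g = "\<lambda>k. h_weight (p ^ k) * infsum h_weight (smooth T)"])
       (auto intro!: has_sum_cmult_right has_sum_infsum IH summable_on_cmult_left
          mult_nonneg_nonneg h_weight_nonneg)
  then have "(\<lambda>x. h_weight (case x of (k, m) \<Rightarrow> p ^ k * m)) summable_on ?A"
    by (rule summable_on_cong[THEN iffD1, rotated])
       (auto simp: h_weight_prime_power_mult[OF p])
  then show ?case
    using summable_on_reindex_bij_betw[OF bij_betw_smooth_insert[OF p, of "\<lambda>_. True"], of h_weight]
    by simp
qed

text \<open>Sum over the exponent \<open>k\<close> of \<open>p\<close> first; additivity moves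
  f(p^k) into the threshold.\<close>

lemma infsum_smooth_insert_sums:
  assumes T: "finite T" "\<And>q. q \<in> T \<Longrightarrow> prime q" and p: "prime p" "p \<notin> T"
  shows "(\<lambda>k. h_weight (p ^ k) * infsum h_weight {m \<in> smooth T. f m \<le> t - f (p ^ k)})
           sums infsum h_weight {m \<in> smooth (insert p T). f m \<le> t}"
proof -
  let ?A = "Sigma (UNIV :: nat set) (\<lambda>k. {m \<in> smooth T. f (p ^ k * m) \<le> t})"
  note bij = bij_betw_smooth_insert[OF p, of "\<lambda>m. f m \<le> t"]
  have "h_weight summable_on smooth (insert p T)"
    using T p by (intro h_weight_summable_smooth) auto
  then have "h_weight summable_on {m \<in> smooth (insert p T). f m \<le> t}"
    by (rule summable_on_subset) auto
  then have "(h_weight has_sum infsum h_weight {m \<in> smooth (insert p T). f m \<le> t})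
      {m \<in> smooth (insert p T). f m \<le> t}" by (rule has_sum_infsum)
  then have "((\<lambda>x. h_weight (case x of (k, m) \<Rightarrow> p ^ k * m)) has_sum
      infsum h_weight {m \<in> smooth (insert p T). f m \<le> t}) ?A"
    using has_sum_reindex_bij_betw[OF bij, of h_weight] by blast
  then have "((\<lambda>(k, m). h_weight (p ^ k) * h_weight m) has_sum
      infsum h_weight {m \<in> smooth (insert p T). f m \<le> t}) ?A"
    by (rule has_sum_cong[THEN iffD1, rotated])
       (auto simp: h_weight_prime_power_mult[OF p])
  then have "((\<lambda>k. h_weight (p ^ k) * infsum h_weight {m \<in> smooth T. f m \<le> t - f (p ^ k)})
      has_sum infsum h_weight {m \<in> smooth (insert p T). f m \<le> t}) UNIV"
  proof (rule has_sum_SigmaD)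
    fix k :: nat
    have "{m \<in> smooth T. f (p ^ k * m) \<le> t} = {m \<in> smooth T. f m \<le> t - f (p ^ k)}"
      using h_weight_prime_power_mult(2)[OF p] by auto
    moreover have "h_weight summable_on {m \<in> smooth T. f m \<le> t - f (p ^ k)}"
      using h_weight_summable_smooth[OF T] by (rule summable_on_subset) auto
    ultimately show "((\<lambda>y. case (k, y) of (k, m) \<Rightarrow> h_weight (p ^ k) * h_weight m) has_sum
        h_weight (p ^ k) * infsum h_weight {m \<in> smooth T. f m \<le> t - f (p ^ k)})
        {m \<in> smooth T. f (p ^ k * m) \<le> t}"
      by (auto intro!: has_sum_cmult_right has_sum_infsum)
  qed
  then show ?thesis by (rule has_sum_imp_sums)
qed

section \<open>Adjoining one prime, and the resulting error bound\<close>

text \<open>In the model the exponent of \<open>p\<close> equals \<open>k\<close> with probability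
  p^(-k) (1 - 1 / p), independently of the primes in \<open>T\<close>. Conditioning on it shifts
  \<open>t\<close> by f(p^k).\<close>

lemma model_insert_sums:
  assumes T: "finite T" "\<And>q. q \<in> T \<Longrightarrow> prime q" and p: "prime p" "p \<notin> T"
  shows "(\<lambda>k. 1 / real p ^ k * (1 - 1 / real p) * model T (t - f (p ^ k))) sums model (insert p T) t"
proof -
  define B where "B = (\<lambda>s. infsum h_weight {m \<in> smooth T. f m \<le> s})"
  define a where "a = (\<lambda>k. 1 / real p ^ k * (1 - 1 / real p) * B (t - f (p ^ k)))"
  define b where "b = (\<lambda>k. (1 - w_fun f p) * (h_weight (p ^ k) * B (t - f (p ^ k))))"
  define v where "v = (\<lambda>k. if k = 0 then 0 else u_fun f (p ^ k) / real p ^ k)"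
  have p1: "real p > 1" using prime_gt_1_nat[OF p(1)] by simp
  have b: "b sums ((1 - w_fun f p) * infsum h_weight {m \<in> smooth (insert p T). f m \<le> t})"
    unfolding b_def B_def by (intro sums_mult infsum_smooth_insert_sums T p)
  \<comment> \<open>For \<open>k \<ge> 1\<close> either \<open>u (p ^ k) = 1\<close> and \<open>a k = b k\<close>, or \<open>f (p ^ k) = 0\<close> and \<open>b k = 0\<close>;
    the latter terms of \<open>a\<close> add up to the missing \<open>(1 - w) B t\<close>.\<close>
  have ab: "a k = b k + ((1 - 1 / real p) * B t * (1 / real p ^ k - v k)
      - (if k = 0 then (1 - w_fun f p) * B t else 0))" for k
  proof (cases "k = 0")
    case True
    then show ?thesis by (simp add: a_def b_def v_def)
  next
    case False
    then have k: "k \<ge> 1" by simp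
    have "b k = u_fun f (p ^ k) / real p ^ k * (1 - 1 / real p) * B (t - f (p ^ k))"
      unfolding b_def using h_weight_prime_power[OF p(1) k] by (simp add: mult.assoc[symmetric])
    then show ?thesis using False u_fun_prime_power[OF p(1) k, of f]
      by (auto simp: a_def v_def)
  qed
  have "(\<lambda>k. b k + ((1 - 1 / real p) * B t * (1 / real p ^ k - v k)
      - (if k = 0 then (1 - w_fun f p) * B t else 0))) sums
      ((1 - w_fun f p) * infsum h_weight {m \<in> smooth (insert p T). f m \<le> t} +
       ((1 - 1 / real p) * B t * (1 / (1 - 1 / real p) - S_fun f p) - (1 - w_fun f p) * B t))"
    unfolding v_def
    by (intro sums_add sums_diff b sums_mult geometric_inverse_prime S_sums p sums_single)
  \<comment> \<open>Since w = (1 - 1 / p) S by definition, the first product is (1 - w) B t.\<close>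
  also have "(1 - 1 / real p) * B t * (1 / (1 - 1 / real p) - S_fun f p) - (1 - w_fun f p) * B t = 0"
    using p1 by (simp add: w_fun_def field_simps)
  finally have "a sums ((1 - w_fun f p) * infsum h_weight {m \<in> smooth (insert p T). f m \<le> t})"
    by (simp add: ab[abs_def])
  from sums_mult[OF this, of "\<Prod>p\<in>T. 1 - w_fun f p"] show ?thesis
    using T p by (simp add: a_def B_def model_def mult_ac)
qed

text \<open>Divide by p^k: as \<open>p\<close> is outside \<open>T\<close>,
  \<open>partial_f T\<close> ignores this factor. The cofactor may still be divisible by
  \<open>p\<close>.\<close>

lemma partial_count_scale:
  assumes T: "\<And>q. q \<in> T \<Longrightarrow> prime q" and p: "prime p" "p \<notin> T"
  shows "real (card {n. n \<ge> 1 \<and> real n \<le> x \<and> p ^ k dvd n \<and> partial_f T n \<le> t})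
           = partial_count T (x / real p ^ k) t"
proof -
  have p0: "real p > 0" "p > 0" using prime_gt_0_nat[OF p(1)] by simp_all
  have "{n. n \<ge> 1 \<and> real n \<le> x \<and> p ^ k dvd n \<and> partial_f T n \<le> t} =
      (\<lambda>n. p ^ k * n) ` {n. n \<ge> 1 \<and> real n \<le> x / real p ^ k \<and> partial_f T n \<le> t}"
    using p0 partial_f_power_mult[OF p T]
    by (fastforce simp: field_simps Suc_le_eq elim!: dvdE)
  then show ?thesis unfolding partial_count_def using p0
    by (simp add: card_image inj_on_def)
qed

text \<open>Integers with exact exponent \<open>k\<close> are the multiples of p^k without the
  multiples of p^(k+1). This expresses the new count through the old one alone, with no coprimality
  condition to \<open>p\<close>.\<close>

lemma partial_count_insert_sums:
  assumes T: "finite T" "\<And>q. q \<in> T \<Longrightarrow> prime q" and p: "prime p" "p \<notin> T"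
  shows "(\<lambda>k. partial_count T (x / real p ^ k) (t - f (p ^ k))
            - partial_count T (x / real p ^ Suc k) (t - f (p ^ k)))
           sums partial_count (insert p T) x t"
proof -
  define S where "S = {n. n \<ge> 1 \<and> real n \<le> x \<and> partial_f (insert p T) n \<le> t}"
  \<comment> \<open>The exponent of \<open>p\<close> in \<open>n\<close> is less than
    \<open>n\<close>, so no \<open>n\<close> up to \<open>x\<close> reaches \<open>K\<close> and the
    series is a finite sum.\<close>
  define K where "K = Suc (nat \<lfloor>x\<rfloor>)"
  have finS: "finite S" unfolding S_def by (rule finite_pos_nat_le_real)
  have mK: "multiplicity p n < K" if "n \<ge> 1" "real n \<le> x" for n
    using multiplicity_less_self[OF p(1) that(1)] le_nat_floor[OF that(2)] by (simp add: K_def)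
  have c: "real (card {n \<in> S. multiplicity p n = k}) =
      partial_count T (x / real p ^ k) (t - f (p ^ k))
      - partial_count T (x / real p ^ Suc k) (t - f (p ^ k))" for k
  proof -
    let ?A = "\<lambda>j. {n. n \<ge> 1 \<and> real n \<le> x \<and> p ^ j dvd n \<and> partial_f T n \<le> t - f (p ^ k)}"
    have "multiplicity p n = k \<longleftrightarrow> p ^ k dvd n \<and> \<not> p ^ Suc k dvd n" if "n \<ge> 1" for n
      using that p(1) prime_gt_1_nat[OF p(1)] by (auto simp: power_dvd_iff_le_multiplicity simp del: power_Suc)
    moreover have "partial_f (insert p T) n = f (p ^ multiplicity p n) + partial_f T n" for n
      unfolding partial_f_def using T(1) p(2) by simp
    ultimately have "{n \<in> S. multiplicity p n = k} = ?A k - ?A (Suc k)"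
      unfolding S_def by (auto simp: algebra_simps)
    moreover have "card (?A k - ?A (Suc k)) = card (?A k) - card (?A (Suc k))"
      by (intro card_Diff_subset finite_pos_nat_le_real) (auto dest: power_le_dvd[of _ _ _ k])
    moreover have "card (?A (Suc k)) \<le> card (?A k)"
      by (intro card_mono finite_pos_nat_le_real) (auto dest: power_le_dvd[of _ _ _ k])
    ultimately show ?thesis
      using partial_count_scale[OF T(2) p, of x _ "t - f (p ^ k)"] by (simp add: of_nat_diff del: power_Suc)
  qed
  have "(\<lambda>k. real (card {n \<in> S. multiplicity p n = k})) sums
      (\<Sum>k<K. real (card {n \<in> S. multiplicity p n = k}))"
  proof (rule sums_finite)
    show "real (card {n \<in> S. multiplicity p n = k}) = 0" if "k \<notin> {..<K}" for k
    proof -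
      have "{n \<in> S. multiplicity p n = k} = {}" using that mK by (auto simp: S_def)
      then show ?thesis by (simp only: card.empty of_nat_0)
    qed
  qed simp
  also have "(\<Sum>k<K. real (card {n \<in> S. multiplicity p n = k})) = real (card S)"
    using sum.group[OF finS, of "{..<K}" "multiplicity p" "\<lambda>_. 1::real"] mK
    by (auto simp: S_def)
  finally show ?thesis unfolding c by (simp add: S_def partial_count_def)
qed


text \<open>Both sides satisfy the same recursion, so the errors can be compared term by term. The
  term for \<open>k\<close> inherits the old error at \<open>x / p ^ k\<close> and
  \<open>x / p ^ (k + 1)\<close>, a factor (1 + s) s^k, and summing over \<open>k\<close> gives (1 +
  s) / (1 - s). The induction needs the bound for all \<open>x > 0\<close> and all
  \<open>t\<close>.\<close>

lemma partial_count_approx_model: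
  assumes "finite T" "\<And>q. q \<in> T \<Longrightarrow> prime q" "0 \<le> \<delta>" "\<delta> < 1" "x > 0"
  shows "\<bar>partial_count T x t - x * model T t\<bar>
           \<le> x powr (1 - \<delta>) * (\<Prod>p\<in>T. (1 + real p powr (\<delta> - 1)) / (1 - real p powr (\<delta> - 1)))"
  using assms(1,2,5)
proof (induction T arbitrary: x t rule: finite_induct)
  case empty
  have "{n. n \<ge> 1 \<and> real n \<le> x} = {1..nat \<lfloor>x\<rfloor>}"
    using empty.prems by (auto simp: le_nat_iff le_floor_iff)
  then have "partial_count {} x t = (if t \<ge> 0 then real (nat \<lfloor>x\<rfloor>) else 0)"
    by (auto simp: partial_count_def partial_f_def)
  moreover have "model {} t = (if t \<ge> 0 then 1 else 0)"
  proof -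
    have "{m \<in> smooth {}. f m \<le> t} = (if t \<ge> 0 then {1} else {})"
      unfolding smooth_empty by auto
    then show ?thesis by (simp add: model_def)
  qed
  ultimately show ?case using floor_approx_le_powr[of x \<delta>] empty.prems assms(3,4) by simp
next
  case (insert p T)
  then have p: "prime p" "p \<notin> T" and T: "finite T" "\<And>q. q \<in> T \<Longrightarrow> prime q" by auto
  define E where "E = (\<Prod>p\<in>T. (1 + real p powr (\<delta> - 1)) / (1 - real p powr (\<delta> - 1)))"
  define s where "s = real p powr (\<delta> - 1)"
  define M where "M = (\<lambda>k. model T (t - f (p ^ k)))"
  have p1: "real p > 1" using prime_gt_1_nat[OF p(1)] by simp
  have s: "0 < s" "s < 1" using p1 assms(4) by (auto simp: s_def powr_less_one)
  have scale: "(x / real p ^ k) powr (1 - \<delta>) = x powr (1 - \<delta>) * s ^ k" for k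
  proof -
    have "(x / real p ^ k) powr (1 - \<delta>) = x powr (1 - \<delta>) / (real p ^ k) powr (1 - \<delta>)"
      using insert.prems p1 by (simp add: powr_divide)
    also have "(real p ^ k) powr (1 - \<delta>) = inverse (s ^ k)"
      using p1 by (simp add: s_def powr_realpow[symmetric] powr_powr powr_minus[symmetric] algebra_simps)
    finally show ?thesis by (simp add: divide_inverse)
  qed
  let ?a = "\<lambda>k. partial_count T (x / real p ^ k) (t - f (p ^ k))
            - partial_count T (x / real p ^ Suc k) (t - f (p ^ k))"
  let ?b = "\<lambda>k. x * (1 / real p ^ k * (1 - 1 / real p) * M k)"
  let ?c = "\<lambda>k. x powr (1 - \<delta>) * E * ((1 + s) * s ^ k)"
  have ab: "(\<lambda>k. ?a k - ?b k) sums (partial_count (insert p T) x t - x * model (insert p T) t)"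
    unfolding M_def
    by (intro sums_diff sums_mult partial_count_insert_sums model_insert_sums T p)
  have c: "?c sums (x powr (1 - \<delta>) * E * ((1 + s) * (1 / (1 - s))))"
    using s by (intro sums_mult geometric_sums) auto
  have bound: "\<bar>?a k - ?b k\<bar> \<le> ?c k" for k
  proof -
    have IH: "\<bar>partial_count T (x / real p ^ j) (t - f (p ^ k)) - x / real p ^ j * M k\<bar>
        \<le> x powr (1 - \<delta>) * s ^ j * E" for j
      unfolding M_def E_def scale[symmetric] using insert.prems p1
      by (intro insert.IH T) auto
    \<comment> \<open>The weight p^(-k) (1 - 1 / p) is split as p^(-k) - p^(-k-1), so that each half
      is matched with one of the two counts.\<close>
    have "?a k - ?b k = (partial_count T (x / real p ^ k) (t - f (p ^ k)) - x / real p ^ k * M k)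
        - (partial_count T (x / real p ^ Suc k) (t - f (p ^ k)) - x / real p ^ Suc k * M k)"
      using p1 by (simp add: field_simps)
    also have "\<bar>\<dots>\<bar> \<le> x powr (1 - \<delta>) * s ^ k * E + x powr (1 - \<delta>) * s ^ Suc k * E"
      using IH[of k] IH[of "Suc k"] by linarith
    also have "\<dots> = ?c k" by (simp add: algebra_simps)
    finally show ?thesis .
  qed
  have "partial_count (insert p T) x t - x * model (insert p T) t
      \<le> x powr (1 - \<delta>) * E * ((1 + s) * (1 / (1 - s)))"
    using bound by (intro sums_le[OF _ ab c]) (auto simp: abs_le_iff)
  moreover have "- (partial_count (insert p T) x t - x * model (insert p T) t)
      \<le> x powr (1 - \<delta>) * E * ((1 + s) * (1 / (1 - s)))"
    using bound by (intro sums_le[OF _ sums_minus[OF ab] c]) (auto simp: abs_le_iff)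
  ultimately show ?case
    using T p by (simp add: E_def s_def abs_le_iff mult_ac)
qed

section \<open>Dependence on the set of primes\<close>

text \<open>Only integers \<open>n\<close> with f(p^k) \<noteq> 0 for some \<open>p\<close> in
  \<open>T' - T\<close>, \<open>k\<close> being the exponent of \<open>p\<close> in
  \<open>n\<close>, are affected. Such an \<open>n\<close> is divisible by \<open>p\<close>, and by
  p^2 if f(p) = 0; the set \<open>U\<close> collects all multiples in question.\<close>

lemma partial_count_diff_le:
  assumes T: "finite T'" "\<And>q. q \<in> T' \<Longrightarrow> prime q" "T \<subseteq> T'" and x: "x \<ge> 0"
  shows "\<bar>partial_count T x t - partial_count T' x t\<bar>
           \<le> x * (\<Sum>p\<in>T' - T. u_fun f p / real p + 1 / real p ^ 2)"
proof -
  define d where "d = (\<lambda>p. if f p \<noteq> 0 then p else p ^ 2)"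
  define U where "U = (\<Union>p\<in>T' - T. {n. n \<ge> 1 \<and> real n \<le> x \<and> d p dvd n})"
  let ?S = "\<lambda>T. {n. n \<ge> 1 \<and> real n \<le> x \<and> partial_f T n \<le> t}"
  have d1: "d p \<ge> 1" if "p \<in> T'" for p
    using T(2)[OF that] by (auto simp: d_def Suc_le_eq prime_gt_0_nat)
  have finU: "finite U" unfolding U_def using T by (intro finite_UN_I finite_pos_nat_le_real) auto
  have same: "partial_f T n = partial_f T' n" if n: "n \<ge> 1" "real n \<le> x" "n \<notin> U" for n
    unfolding partial_f_def
  proof (rule sum.mono_neutral_left)
    show "\<forall>p\<in>T' - T. f (p ^ multiplicity p n) = 0"
    proof
      fix p assume p: "p \<in> T' - T"
      then have nd: "\<not> d p dvd n" and pr: "prime p" using n T(2) by (auto simp: U_def)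
      show "f (p ^ multiplicity p n) = 0"
      proof (cases "f p = 0")
        case True
        then have "\<not> p ^ 2 dvd n" using nd by (simp add: d_def)
        then have "multiplicity p n < 2"
          using n pr by (intro multiplicity_lessI) auto
        then have "multiplicity p n = 0 \<or> multiplicity p n = 1" by linarith
        then show ?thesis using True by auto
      next
        case False
        then have "multiplicity p n = 0"
          using nd by (simp add: d_def not_dvd_imp_multiplicity_0)
        then show ?thesis by simp
      qed
    qed
  qed (use T in auto)
  have le: "real (card (?S T1)) \<le> real (card (?S T2)) + real (card U)"
    if "T1 \<in> {T, T'}" "T2 \<in> {T, T'}" for T1 T2
  proof -
    have "?S T1 \<subseteq> ?S T2 \<union> U" using same that by auto
    then have "card (?S T1) \<le> card (?S T2 \<union> U)"
      by (intro card_mono finite_UnI finite_pos_nat_le_real finU)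
    also have "\<dots> \<le> card (?S T2) + card U" by (rule card_Un_le)
    finally show ?thesis by linarith
  qed
  have "real (card U) \<le> (\<Sum>p\<in>T' - T. real (card {n. n \<ge> 1 \<and> real n \<le> x \<and> d p dvd n}))"
    unfolding U_def of_nat_sum[symmetric] using T(1) by (intro of_nat_mono card_UN_le) auto
  also have "\<dots> \<le> (\<Sum>p\<in>T' - T. x * (u_fun f p / real p + 1 / real p ^ 2))"
  proof (rule sum_mono)
    fix p assume p: "p \<in> T' - T"
    have "real (card {n. n \<ge> 1 \<and> real n \<le> x \<and> d p dvd n}) \<le> x / real (d p)"
      using d1 p x by (intro card_multiples_le) auto
    also have "\<dots> = x * (1 / real (d p))" by simp
    also have "\<dots> \<le> x * (u_fun f p / real p + 1 / real p ^ 2)"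
      using u_prime[of p] T(2) p x by (intro mult_left_mono) (auto simp: d_def)
    finally show "real (card {n. n \<ge> 1 \<and> real n \<le> x \<and> d p dvd n})
        \<le> x * (u_fun f p / real p + 1 / real p ^ 2)" .
  qed
  finally have "real (card U) \<le> x * (\<Sum>p\<in>T' - T. u_fun f p / real p + 1 / real p ^ 2)"
    by (simp add: sum_distrib_left)
  then show ?thesis using le[of T T'] le[of T' T] by (auto simp: partial_count_def abs_le_iff)
qed

text \<open>Any fixed \<delta> strictly between 0 and 1 would do, since the product over
  \<open>T\<close> does not depend on \<open>x\<close>; here \<delta> = 1/2.\<close>

lemma partial_count_tendsto_model:
  assumes "finite T" "\<And>q. q \<in> T \<Longrightarrow> prime q"
  shows "((\<lambda>x. partial_count T x t / x) \<longlongrightarrow> model T t) at_top"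
proof -
  define E where "E = (\<Prod>p\<in>T. (1 + real p powr (1/2 - 1)) / (1 - real p powr (1/2 - 1)))"
  have "((\<lambda>x. partial_count T x t / x - model T t) \<longlongrightarrow> 0) at_top"
  proof (rule Lim_null_comparison)
    show "\<forall>\<^sub>F x in at_top. norm (partial_count T x t / x - model T t) \<le> x powr (-1/2) * E"
      using eventually_gt_at_top[of "0::real"]
    proof eventually_elim
      case (elim x)
      have "norm (partial_count T x t / x - model T t) = \<bar>partial_count T x t - x * model T t\<bar> / x"
        using elim by (simp add: field_simps)
      also have "\<dots> \<le> x powr (1 - 1/2) * E / x"
        unfolding E_def using partial_count_approx_model[OF assms, of "1/2" x t] elim
        by (intro divide_right_mono) auto
      also have "\<dots> = x powr (1 - 1/2 - 1) * E"
        using elim by (simp only: powr_diff powr_one) simp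
      finally show ?case by simp
    qed
    have "((\<lambda>x::real. x powr (-1/2)) \<longlongrightarrow> 0) at_top"
      by (rule tendsto_neg_powr) (auto simp: filterlim_ident)
    then show "((\<lambda>x. x powr (-1/2) * E) \<longlongrightarrow> 0) at_top" by (rule tendsto_mult_left_zero)
  qed
  then show ?thesis by (rule LIM_zero_cancel)
qed

lemma partial_count_bounds:
  assumes "x > 0"
  shows "0 \<le> partial_count T x t / x" "partial_count T x t / x \<le> 1"
proof -
  show "0 \<le> partial_count T x t / x" using assms by (simp add: partial_count_def)
  have "card {n. n \<ge> 1 \<and> real n \<le> x \<and> partial_f T n \<le> t} \<le> card {n. n \<ge> 1 \<and> real n \<le> x \<and> 1 dvd n}"
    by (intro card_mono finite_pos_nat_le_real) auto
  then have "partial_count T x t \<le> x"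
    unfolding partial_count_def using card_multiples_le(2)[of 1 x] assms by simp
  then show "partial_count T x t / x \<le> 1" using assms by simp
qed

text \<open>Inherited from the relative frequencies of which the model is the limit.\<close>

lemma model_bounds:
  assumes "finite T" "\<And>q. q \<in> T \<Longrightarrow> prime q"
  shows "0 \<le> model T t" "model T t \<le> 1"
proof -
  show "0 \<le> model T t"
    by (rule tendsto_lowerbound[OF partial_count_tendsto_model[OF assms]])
       (auto intro!: eventually_mono[OF eventually_gt_at_top[of 0]] partial_count_bounds)
  show "model T t \<le> 1"
    by (rule tendsto_upperbound[OF partial_count_tendsto_model[OF assms]])
       (auto intro!: eventually_mono[OF eventually_gt_at_top[of 0]] partial_count_bounds)
qed

text \<open>The comparison of counts, divided by \<open>x\<close>, survives the limit.\<close>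

lemma model_diff_le:
  assumes T: "finite T'" "\<And>q. q \<in> T' \<Longrightarrow> prime q" "T \<subseteq> T'"
  shows "\<bar>model T t - model T' t\<bar> \<le> (\<Sum>p\<in>T' - T. u_fun f p / real p + 1 / real p ^ 2)"
proof (rule tendsto_upperbound)
  show "((\<lambda>x. \<bar>partial_count T x t / x - partial_count T' x t / x\<bar>) \<longlongrightarrow> \<bar>model T t - model T' t\<bar>) at_top"
    using T by (intro tendsto_rabs tendsto_diff partial_count_tendsto_model)
      (auto intro: finite_subset)
  show "\<forall>\<^sub>F x in at_top. \<bar>partial_count T x t / x - partial_count T' x t / x\<bar>
      \<le> (\<Sum>p\<in>T' - T. u_fun f p / real p + 1 / real p ^ 2)"
    using eventually_gt_at_top[of "0::real"]
  proof eventually_elim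
    case (elim x)
    have "\<bar>partial_count T x t / x - partial_count T' x t / x\<bar> =
        \<bar>partial_count T x t - partial_count T' x t\<bar> / x"
      using elim by (simp add: diff_divide_distrib[symmetric])
    also have "\<dots> \<le> (\<Sum>p\<in>T' - T. u_fun f p / real p + 1 / real p ^ 2)"
      using partial_count_diff_le[OF T, of x t] elim by (simp add: field_simps)
    finally show ?case .
  qed
qed auto

section \<open>Passing to all primes and identifying the limit\<close>

definition primes_upto :: "nat \<Rightarrow> nat set" where
  "primes_upto N = {p. prime p \<and> p \<le> N}"

lemma finite_primes_upto [simp]: "finite (primes_upto N)"
  by (rule finite_subset[of _ "{..N}"]) (auto simp: primes_upto_def)

text \<open>Integers up to \<open>x\<close> have no prime factor above \<open>N\<close>. The freedom
  in \<open>N\<close> lets the set of primes be enlarged later to contain a given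
  \<open>T\<close>.\<close>

lemma empirical_distr_eq_partial_count:
  assumes "x \<ge> 1" "x \<le> real N"
  shows "empirical_distr f x t = partial_count (primes_upto N) x t / x"
proof -
  have "partial_f (primes_upto N) n = f n" if "n \<ge> 1" "real n \<le> x" for n
  proof (rule partial_f_eq_f)
    have "n \<le> N" using that assms by simp
    then show "prime_factors n \<subseteq> primes_upto N"
      using that(1) by (auto simp: primes_upto_def in_prime_factors_iff dest!: dvd_imp_le)
  qed (use that in \<open>auto simp: primes_upto_def\<close>)
  then have "{n. n \<ge> 1 \<and> real n \<le> x \<and> partial_f (primes_upto N) n \<le> t} =
      {n. n \<ge> 1 \<and> real n \<le> x \<and> f n \<le> t}" by auto
  then show ?thesis by (simp add: empirical_distr_def partial_count_def)
qed

lemma smooth_primes_upto: "{1..N} \<subseteq> smooth (primes_upto N)"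
  by (auto simp: smooth_def primes_upto_def in_prime_factors_iff dest!: dvd_imp_le)

context
  assumes sum_inverse: "summable (\<lambda>p. if prime p \<and> f p \<noteq> 0 then 1 / real p else 0)"
begin

lemma convergent_prod_w: "convergent_prod (\<lambda>p. if prime p then 1 - w_fun f p else 1)"
proof (intro abs_convergent_prod_imp_convergent_prod summable_imp_abs_convergent_prod)
  have sq: "summable (\<lambda>p. 1 / real p ^ 2)" using inverse_power_summable[of 2, where ?'a=real]
    by (simp add: divide_inverse)
  show "summable (\<lambda>p. norm ((if prime p then 1 - w_fun f p else 1) - 1))"
  proof (rule summable_comparison_test'[OF summable_add[OF sum_inverse sq], of 0])
    fix p :: nat
    show "norm (norm ((if prime p then 1 - w_fun f p else 1) - 1))
        \<le> (if prime p \<and> f p \<noteq> 0 then 1 / real p else 0) + 1 / real p ^ 2"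
      using w_nonneg[of p] w_bound[of p] u_prime[of p] by auto
  qed
qed

lemma tendsto_prod_w:
  "(\<lambda>N. \<Prod>p\<in>primes_upto N. 1 - w_fun f p) \<longlonglongrightarrow> (\<Prod>p. if prime p then 1 - w_fun f p else 1)"
proof -
  have "(\<Prod>p\<in>primes_upto N. 1 - w_fun f p) = (\<Prod>p\<le>N. if prime p then 1 - w_fun f p else 1)" for N
    unfolding primes_upto_def by (subst prod.inter_filter[symmetric]) (auto intro!: prod.cong)
  then show ?thesis using convergent_prod_LIMSEQ[OF convergent_prod_w] by simp
qed

text \<open>The limit is nonnegative, and a convergent infinite product without vanishing factors is
  nonzero. Positivity is what allows dividing by this product to bound sums of
  \<open>h_weight\<close>.\<close>

lemma prod_w_pos: "(\<Prod>p. if prime p then 1 - w_fun f p else 1) > 0"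
proof -
  have "(\<Prod>p\<in>primes_upto N. 1 - w_fun f p) \<ge> 0" for N
  proof (rule prod_nonneg)
    fix p assume "p \<in> primes_upto N"
    then show "1 - w_fun f p \<ge> 0" using one_minus_w(1)[of p] by (simp add: primes_upto_def)
  qed
  then have "(\<Prod>p. if prime p then 1 - w_fun f p else 1) \<ge> 0"
    by (intro tendsto_lowerbound[OF tendsto_prod_w]) auto
  moreover have "(\<Prod>p. if prime p then 1 - w_fun f p else 1) \<noteq> 0"
  proof (rule prodinf_nonzero[OF convergent_prod_w])
    fix p show "(if prime p then 1 - w_fun f p else 1) \<noteq> 0"
      using one_minus_w(1)[of p] by auto
  qed
  ultimately show ?thesis by linarith
qed

lemma prod_w_le:
  "(\<Prod>p. if prime p then 1 - w_fun f p else 1) \<le> (\<Prod>p\<in>primes_upto N. 1 - w_fun f p)"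
proof (rule tendsto_upperbound[OF tendsto_prod_w])
  show "\<forall>\<^sub>F M in sequentially. (\<Prod>p\<in>primes_upto M. 1 - w_fun f p) \<le> (\<Prod>p\<in>primes_upto N. 1 - w_fun f p)"
    using eventually_ge_at_top[of N]
  proof eventually_elim
    case (elim M)
    then have "primes_upto N \<subseteq> primes_upto M" by (auto simp: primes_upto_def)
    moreover have "0 \<le> 1 - w_fun f p" "1 - w_fun f p \<le> 1" if "p \<in> primes_upto M" for p
      using one_minus_w[of p] that by (auto simp: primes_upto_def)
    ultimately show ?case
      by (subst prod.subset_diff[of "primes_upto N" "primes_upto M"])
         (auto intro!: mult_left_le_one_le prod_le_1 prod_nonneg)
  qed
qed auto

\<comment> \<open>The model is a probability measure, so the Euler product bounds the sum.\<close>
lemma h_weight_summable: "h_weight summable_on {1..}"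
proof (rule nonneg_bdd_above_summable_on)
  define P where "P = (\<Prod>p. if prime p then 1 - w_fun f p else 1)"
  have "sum h_weight F \<le> 1 / P" if F: "F \<subseteq> {1..}" "finite F" for F
  proof -
    \<comment> \<open>\<open>N\<close> and \<open>t\<close> are so large that \<open>F\<close> lies
      in the index set of the model; \<open>insert 0\<close> guards \<open>Max\<close> against empty
      sets.\<close>
    define N where "N = Max (insert 0 F)"
    define t where "t = Max (insert 0 (f ` F))"
    have "F \<subseteq> {1..N}" using F by (auto simp: N_def)
    then have sub: "F \<subseteq> {m \<in> smooth (primes_upto N). f m \<le> t}"
      using F smooth_primes_upto[of N] by (auto simp: t_def)
    have "h_weight summable_on smooth (primes_upto N)"
      by (intro h_weight_summable_smooth) (auto simp: primes_upto_def)
    then have "h_weight summable_on {m \<in> smooth (primes_upto N). f m \<le> t}"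
      by (rule summable_on_subset) auto
    then have "sum h_weight F \<le> infsum h_weight {m \<in> smooth (primes_upto N). f m \<le> t}" (is "_ \<le> ?I")
      using sub F by (intro finite_sum_le_infsum h_weight_nonneg) auto
    moreover have "?I \<ge> 0" by (intro infsum_nonneg h_weight_nonneg)
    then have "P * ?I \<le> model (primes_upto N) t"
      unfolding model_def P_def by (intro mult_right_mono prod_w_le)
    moreover have "model (primes_upto N) t \<le> 1"
      by (rule model_bounds) (auto simp: primes_upto_def)
    ultimately show ?thesis using prod_w_pos unfolding P_def[symmetric]
      by (smt (verit) mult.commute pos_le_divide_eq)
  qed
  then show "bdd_above (sum h_weight ` {F. F \<subseteq> {1..} \<and> finite F})"
    by (intro bdd_aboveI[of _ "1 / P"]) auto
qed (rule h_weight_nonneg)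

text \<open>Integers composed of primes up to \<open>N\<close> include all of \<open>{1..N}\<close>,
  so the truncated sum is squeezed between a partial sum and the full sum.\<close>

lemma model_tendsto_limit_distr: "(\<lambda>N. model (primes_upto N) t) \<longlonglongrightarrow> limit_distr f t"
proof -
  let ?A = "{m. m \<ge> 1 \<and> f m \<le> t}"
  have sA: "h_weight summable_on ?A"
    using h_weight_summable by (rule summable_on_subset) auto
  define g where "g = (\<lambda>m. if m \<in> ?A then h_weight m else 0)"
  have "(g has_sum infsum h_weight ?A) UNIV"
    using has_sum_infsum[OF sA] by (rule has_sum_cong_neutral[THEN iffD1, rotated 3]) (auto simp: g_def)
  then have lim: "(\<lambda>N. \<Sum>m\<le>N. g m) \<longlonglongrightarrow> infsum h_weight ?A"
    using has_sum_imp_sums sums_def_le by blast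
  have lower: "(\<Sum>m\<le>N. g m) \<le> infsum h_weight {m \<in> smooth (primes_upto N). f m \<le> t}"
    and upper: "infsum h_weight {m \<in> smooth (primes_upto N). f m \<le> t} \<le> infsum h_weight ?A" for N
  proof -
    have sub: "{m \<in> smooth (primes_upto N). f m \<le> t} \<subseteq> ?A" by (auto simp: smooth_def)
    then have s: "h_weight summable_on {m \<in> smooth (primes_upto N). f m \<le> t}"
      by (rule summable_on_subset[OF sA])
    show "infsum h_weight {m \<in> smooth (primes_upto N). f m \<le> t} \<le> infsum h_weight ?A"
      using sub by (intro infsum_mono2 s sA h_weight_nonneg)
    have "(\<Sum>m\<le>N. g m) = sum h_weight {m \<in> {..N}. m \<in> ?A}"
      unfolding g_def by (rule sum.inter_filter[symmetric]) simp
    also have "\<dots> \<le> infsum h_weight {m \<in> smooth (primes_upto N). f m \<le> t}"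
      using smooth_primes_upto[of N] by (intro finite_sum_le_infsum s h_weight_nonneg) auto
    finally show "(\<Sum>m\<le>N. g m) \<le> infsum h_weight {m \<in> smooth (primes_upto N). f m \<le> t}" .
  qed
  have "(\<lambda>N. infsum h_weight {m \<in> smooth (primes_upto N). f m \<le> t})
      \<longlonglongrightarrow> infsum h_weight ?A"
    by (rule tendsto_sandwich[OF always_eventually[OF allI[OF lower]]
          always_eventually[OF allI[OF upper]] lim tendsto_const])
  from tendsto_mult[OF tendsto_prod_w this] show ?thesis
    by (simp add: model_def limit_distr_def h_weight_def[abs_def])
qed

lemma limit_distr_bounds: "0 \<le> limit_distr f t" "limit_distr f t \<le> 1"
proof -
  have "0 \<le> model (primes_upto N) t" "model (primes_upto N) t \<le> 1" for N
    by (rule model_bounds; simp add: primes_upto_def)+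
  then show "0 \<le> limit_distr f t" "limit_distr f t \<le> 1"
    using tendsto_lowerbound[OF model_tendsto_limit_distr[of t], of 0]
      tendsto_upperbound[OF model_tendsto_limit_distr[of t], of 1] by simp_all
qed

section \<open>Quantitative comparison of the two distributions\<close>

text \<open>Triangle inequality through \<open>partial_count T x t / x\<close> and
  \<open>model T t\<close>. The primes outside \<open>T\<close> are paid for twice, once for the
  integers up to \<open>x\<close> and once for the limit.\<close>

lemma empirical_distr_limit_distr_diff:
  assumes T: "finite T" "\<And>q. q \<in> T \<Longrightarrow> prime q"
    and tail: "\<And>N. (\<Sum>p\<in>primes_upto N - T. u_fun f p / real p + 1 / real p ^ 2) \<le> \<tau>"
    and \<delta>: "0 \<le> \<delta>" "\<delta> < 1" and x: "x \<ge> 1"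
  shows "\<bar>empirical_distr f x t - limit_distr f t\<bar> \<le> 2 * \<tau> +
           x powr - \<delta> * (\<Prod>p\<in>T. (1 + real p powr (\<delta> - 1)) / (1 - real p powr (\<delta> - 1)))"
proof -
  define M where "M = Max (insert 0 T)"
  have sub: "T \<subseteq> primes_upto N" if "N \<ge> M" for N
  proof
    fix p assume p: "p \<in> T"
    then have "p \<le> M" using T(1) by (simp add: M_def)
    then show "p \<in> primes_upto N" using p T(2) that by (simp add: primes_upto_def)
  qed
  define N where "N = max M (nat \<lceil>x\<rceil>)"
  have 1: "\<bar>partial_count T x t / x - empirical_distr f x t\<bar> \<le> \<tau>"
  proof -
    have "x \<le> real N" unfolding N_def by linarith
    then have "\<bar>partial_count T x t / x - empirical_distr f x t\<bar> =
        \<bar>partial_count T x t - partial_count (primes_upto N) x t\<bar> / x"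
      using x by (simp add: empirical_distr_eq_partial_count diff_divide_distrib[symmetric])
    also have "\<dots> \<le> (x * (\<Sum>p\<in>primes_upto N - T. u_fun f p / real p + 1 / real p ^ 2)) / x"
      using x by (intro divide_right_mono partial_count_diff_le sub)
        (auto simp: N_def primes_upto_def)
    also have "\<dots> = (\<Sum>p\<in>primes_upto N - T. u_fun f p / real p + 1 / real p ^ 2)"
      using x by simp
    finally show ?thesis using tail[of N] by linarith
  qed
  define E where "E = (\<Prod>p\<in>T. (1 + real p powr (\<delta> - 1)) / (1 - real p powr (\<delta> - 1)))"
  have 2: "\<bar>partial_count T x t / x - model T t\<bar> \<le> x powr - \<delta> * E"
  proof -
    have "\<bar>partial_count T x t / x - model T t\<bar> = \<bar>partial_count T x t - x * model T t\<bar> / x"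
      using x by (simp add: field_simps)
    also have "\<dots> \<le> x powr (1 - \<delta>) * E / x"
      unfolding E_def using partial_count_approx_model[OF T \<delta>, of x t] x
      by (intro divide_right_mono) auto
    also have "\<dots> = x powr - \<delta> * E"
      using x by (simp add: powr_diff powr_minus divide_inverse)
    finally show ?thesis .
  qed
  have 3: "\<bar>model T t - limit_distr f t\<bar> \<le> \<tau>"
  proof (rule tendsto_upperbound)
    show "(\<lambda>N. \<bar>model T t - model (primes_upto N) t\<bar>) \<longlonglongrightarrow> \<bar>model T t - limit_distr f t\<bar>"
      by (intro tendsto_intros model_tendsto_limit_distr)
    show "\<forall>\<^sub>F N in sequentially. \<bar>model T t - model (primes_upto N) t\<bar> \<le> \<tau>"
      using eventually_ge_at_top[of M]
    proof eventually_elim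
      case (elim N)
      then have "\<bar>model T t - model (primes_upto N) t\<bar>
          \<le> (\<Sum>p\<in>primes_upto N - T. u_fun f p / real p + 1 / real p ^ 2)"
        by (intro model_diff_le sub) (auto simp: primes_upto_def)
      also note tail[of N]
      finally show ?case .
    qed
  qed auto
  show ?thesis using 1 2 3 unfolding E_def by linarith
qed

lemma u_div_summable_on: "(\<lambda>p. u_fun f p / real p) summable_on {p. prime p \<and> real p > y}"
proof -
  let ?g = "\<lambda>p. if prime p \<and> f p \<noteq> 0 then 1 / real p else 0"
  have "?g summable_on UNIV"
    using sum_inverse by (subst summable_on_UNIV_nonneg_real_iff) auto
  then have "?g summable_on {p. prime p \<and> real p > y}" by (rule summable_on_subset) auto
  then show ?thesis by (rule summable_on_cong[THEN iffD1, rotated]) (simp add: u_prime)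
qed

lemma alpha_nonneg: "alpha_fun f y \<ge> 0"
  unfolding alpha_fun_def by (intro infsum_nonneg) (simp add: u_nonneg)

text \<open>Primes with f(p) = 0 may lie below \<open>y\<close> because their summands
  vanish.\<close>

lemma sum_u_div_le_alpha:
  assumes "finite F" "\<And>p. p \<in> F \<Longrightarrow> prime p \<and> (f p = 0 \<or> real p > y)"
  shows "(\<Sum>p\<in>F. u_fun f p / real p) \<le> alpha_fun f y"
proof -
  have "(\<Sum>p\<in>F. u_fun f p / real p) = (\<Sum>p\<in>{p \<in> F. real p > y}. u_fun f p / real p)"
    using assms by (intro sum.mono_neutral_right) (auto simp: u_prime)
  also have "\<dots> \<le> alpha_fun f y"
    unfolding alpha_fun_def using assms
    by (intro finite_sum_le_infsum u_div_summable_on) (auto simp: u_nonneg)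
  finally show ?thesis .
qed

lemma empirical_distr_error_bound:
  fixes y w \<delta> :: real
  assumes x: "x \<ge> 1" and w: "w \<ge> 1" and y: "y > 0" and \<delta>: "0 \<le> \<delta>" "\<delta> \<le> 1 / 4" "w powr \<delta> \<le> 2"
  defines "K \<equiv> (\<Sum>p. if prime p \<and> f p \<noteq> 0 then 1 / real p else 0)"
  shows "\<bar>empirical_distr f x t - limit_distr f t\<bar>
           \<le> 2 * alpha_fun f y + 4 / w + x powr - \<delta> * exp (6 * y powr \<delta> * K + 12) * w powr 12"
proof -
  \<comment> \<open>Outside \<open>T1\<close> every prime with f(p) \<noteq> 0 exceeds
    \<open>y\<close>, which bounds the first part of the tail by \<open>alpha_fun f y\<close>;
    outside \<open>T2\<close> every prime exceeds \<open>w\<close>, which bounds the squares by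
    \<open>2 / w\<close>.\<close>
  define T1 where "T1 = {p. prime p \<and> f p \<noteq> 0 \<and> real p \<le> y}"
  define T2 where "T2 = {p. prime p \<and> real p \<le> w}"
  have fin: "finite T1" "finite T2"
    by (rule finite_subset[OF _ finite_atMost[of "nat \<lfloor>y\<rfloor>"]]
        finite_subset[OF _ finite_atMost[of "nat \<lfloor>w\<rfloor>"]]; auto simp: T1_def T2_def le_nat_floor)+
  have tail: "(\<Sum>p\<in>primes_upto N - (T1 \<union> T2). u_fun f p / real p + 1 / real p ^ 2) \<le> alpha_fun f y + 2 / w" for N
    unfolding sum.distrib
    by (intro add_mono sum_u_div_le_alpha sum_inverse_squares_le w)
       (auto simp: primes_upto_def T1_def T2_def)
  define E where "E = (\<Prod>p\<in>T1 \<union> T2. (1 + real p powr (\<delta> - 1)) / (1 - real p powr (\<delta> - 1)))"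
  have diff: "\<bar>empirical_distr f x t - limit_distr f t\<bar> \<le> 2 * (alpha_fun f y + 2 / w) + x powr - \<delta> * E"
    unfolding E_def using \<delta> x fin tail
    by (intro empirical_distr_limit_distr_diff sum_inverse) (auto simp: T1_def T2_def)
  have "E \<le> exp (6 * (\<Sum>p\<in>T1 \<union> T2. real p powr (\<delta> - 1)))"
    unfolding E_def using fin \<delta> by (intro prod_le_exp_sum) (auto simp: T1_def T2_def)
  \<comment> \<open>Write p^(\<delta>-1) as p^\<delta> / p and bound p^\<delta> by its value at the
    upper end. Over \<open>T1\<close> the convergent series \<open>K\<close> controls the rest; over
    \<open>T2\<close> it is a harmonic sum, and p^\<delta> \<le> 2.\<close>
  also have "(\<Sum>p\<in>T1 \<union> T2. real p powr (\<delta> - 1)) \<le> y powr \<delta> * K + 2 * (1 + ln w)"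
  proof -
    have le: "(\<Sum>p\<in>S. real p powr (\<delta> - 1)) \<le> z powr \<delta> * (\<Sum>p\<in>S. 1 / real p)"
      if "\<And>p. p \<in> S \<Longrightarrow> prime p \<and> real p \<le> z" for S z
      unfolding sum_distrib_left
    proof (rule sum_mono)
      fix p assume p: "p \<in> S"
      then have p0: "real p > 0" using that prime_gt_0_nat by auto
      then have "real p powr (\<delta> - 1) = real p powr \<delta> * (1 / real p)" by (simp add: powr_diff)
      also have "\<dots> \<le> z powr \<delta> * (1 / real p)"
        using that[OF p] \<delta> by (intro mult_right_mono powr_mono2) auto
      finally show "real p powr (\<delta> - 1) \<le> z powr \<delta> * (1 / real p)" .
    qed
    have "(\<Sum>p\<in>T1 \<union> T2. real p powr (\<delta> - 1)) \<le>
        (\<Sum>p\<in>T1. real p powr (\<delta> - 1)) + (\<Sum>p\<in>T2. real p powr (\<delta> - 1))"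
      using fin by (simp add: sum_Un sum_nonneg)
    also have "\<dots> \<le> y powr \<delta> * K + 2 * (1 + ln w)"
    proof (rule add_mono)
      have "(\<Sum>p\<in>T1. 1 / real p) = (\<Sum>p\<in>T1. if prime p \<and> f p \<noteq> 0 then 1 / real p else 0)"
        by (intro sum.cong) (auto simp: T1_def)
      also have "\<dots> \<le> K" unfolding K_def
        by (intro sum_le_suminf sum_inverse fin) auto
      finally have "y powr \<delta> * (\<Sum>p\<in>T1. 1 / real p) \<le> y powr \<delta> * K"
        by (intro mult_left_mono) auto
      moreover have "(\<Sum>p\<in>T1. real p powr (\<delta> - 1)) \<le> y powr \<delta> * (\<Sum>p\<in>T1. 1 / real p)"
        by (rule le) (simp add: T1_def)
      ultimately show "(\<Sum>p\<in>T1. real p powr (\<delta> - 1)) \<le> y powr \<delta> * K" by linarith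
      have "(\<Sum>p\<in>T2. real p powr (\<delta> - 1)) \<le> w powr \<delta> * (\<Sum>p\<in>T2. 1 / real p)"
        by (rule le) (simp add: T2_def)
      also have "\<dots> \<le> 2 * (1 + ln w)"
        using w \<delta> by (intro mult_mono sum_inverse_le_ln sum_nonneg)
          (auto simp: T2_def Suc_le_eq prime_gt_0_nat)
      finally show "(\<Sum>p\<in>T2. real p powr (\<delta> - 1)) \<le> 2 * (1 + ln w)" .
    qed
    finally show ?thesis .
  qed
  \<comment> \<open>Both occurrences of 12 are 6 * 2; the term 12 * \<open>ln w\<close> becomes the
    power of \<open>w\<close>.\<close>
  also have "exp (6 * (y powr \<delta> * K + 2 * (1 + ln w))) = exp (6 * y powr \<delta> * K + 12) * w powr 12"
    using w by (simp add: powr_def exp_add[symmetric] algebra_simps)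
  finally have "E \<le> exp (6 * y powr \<delta> * K + 12) * w powr 12" by simp
  then have "x powr - \<delta> * E \<le> x powr - \<delta> * (exp (6 * y powr \<delta> * K + 12) * w powr 12)"
    by (intro mult_left_mono) auto
  with diff show ?thesis by (simp add: mult.assoc)
qed

end

end

section \<open>Choice of the parameters\<close>

theorem theorem1p1:
  fixes f :: "nat \<Rightarrow> real"
  assumes "additive_arith f"
    and "summable (\<lambda>p. if prime p then min 1 ((f p)\<^sup>2) / real p else 0)"
    and "summable (\<lambda>p. if prime p \<and> \<bar>f p\<bar> \<le> 1 then f p / real p else 0)"
    and "summable (\<lambda>p. if prime p \<and> f p \<noteq> 0 then 1 / real p else 0)"
  shows "\<exists>C::real. \<forall>x::real. x \<ge> 3 \<longrightarrow>
           (SUP y::real. ereal \<bar>empirical_distr f x y - limit_distr f y\<bar>)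
             \<le> ereal (C * (alpha_fun f (x powr (1 / ln (ln x)))
                         + beta_fun f (sqrt x) powr (1 / 4)
                         + 1 / (ln x) powr (1 / 6)))"
proof -
  interpret additive_function f by unfold_locales (rule assms(1))
  note sm = assms(4)
  define K where "K = (\<Sum>p. if prime p \<and> f p \<noteq> 0 then 1 / real p else 0)"
  define D where "D = exp (6 * exp 3 * K + 12)"
  \<comment> \<open>In terms of the \<open>L\<close>, \<open>\<delta>\<close> and \<open>w\<close>
    defined below, the three conditions read L > e, \<delta> < 1/4 and ln(w^\<delta>) < 1/2. The
    last gives w^\<delta> \<le> 2, as ln 2 \<ge> 2/3.\<close>
  have "\<forall>\<^sub>F x::real in at_top. ln x > exp 1" by real_asymp
  moreover have "\<forall>\<^sub>F x::real in at_top. 3 * ln (ln x) / ln x < 1 / 4" by real_asymp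
  moreover have "\<forall>\<^sub>F x::real in at_top. 1 / 6 * ln (ln x) * (3 * ln (ln x) / ln x) < 1 / 2"
    by real_asymp
  ultimately have "\<forall>\<^sub>F x::real in at_top. ln x > exp 1 \<and> 3 * ln (ln x) / ln x < 1 / 4
      \<and> 1 / 6 * ln (ln x) * (3 * ln (ln x) / ln x) < 1 / 2" by eventually_elim simp
  then obtain X :: real where X: "\<And>x. x \<ge> X \<Longrightarrow> ln x > exp 1 \<and> 3 * ln (ln x) / ln x < 1 / 4
      \<and> 1 / 6 * ln (ln x) * (3 * ln (ln x) / ln x) < 1 / 2"
    unfolding eventually_at_top_linorder by blast
  define X' where "X' = max X 3"
  have ln3: "ln x \<ge> 1" if "x \<ge> 3" for x :: real
    using that exp_le by (subst ln_ge_iff) auto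
  \<comment> \<open>The first two summands serve large \<open>x\<close>, where 2 and 4 +
    \<open>D\<close> are required; the last one serves the bounded range up to
    \<open>X'\<close>.\<close>
  define C where "C = 6 + D + ln X' powr (1 / 6)"
  have D0: "D \<ge> 0" by (simp add: D_def)
  then have C: "C \<ge> 2" "C \<ge> 4 + D" "C \<ge> ln X' powr (1 / 6)" by (auto simp: C_def)
  have large: "\<bar>empirical_distr f x t - limit_distr f t\<bar>
      \<le> C * (alpha_fun f (x powr (1 / ln (ln x))) + 1 / ln x powr (1 / 6))"
    if x: "x \<ge> X'" for x t
  proof -
    define L where "L = ln x"
    \<comment> \<open>As ln y = L / ln L, this makes y^\<delta> = e^3 constant and x^(-\<delta>) =
      L^(-3). With w^12 = L^2 the error is then a multiple of 1 / L, below the required 1 / w =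
      L^(-1/6).\<close>
    define \<delta> where "\<delta> = 3 * ln L / L"
    define w where "w = L powr (1 / 6)"
    define y where "y = x powr (1 / ln L)"
    have x3: "x \<ge> 3" and XX: "L > exp 1" "\<delta> < 1 / 4" "1 / 6 * ln L * \<delta> < 1 / 2"
      using X[of x] x by (auto simp: X'_def L_def \<delta>_def)
    have L1: "L > 1" using XX(1) exp_ge_add_one_self[of 1] by linarith
    then have lnL: "ln L > 0" by simp
    have w1: "w \<ge> 1" using L1 by (simp add: w_def ge_one_powr_ge_zero)
    have y0: "y > 0" using x3 by (simp add: y_def)
    have \<delta>0: "\<delta> \<ge> 0" using L1 lnL by (simp add: \<delta>_def)
    have "w powr \<delta> = exp (1 / 6 * ln L * \<delta>)"
      using L1 by (simp add: w_def powr_powr powr_def mult_ac)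
    also have "\<dots> \<le> exp (ln 2)" using XX(3) ln2_ge_two_thirds by (intro iffD2[OF exp_le_cancel_iff]) linarith
    finally have w2: "w powr \<delta> \<le> 2" by simp
    have y\<delta>: "y powr \<delta> = exp 3"
      using x3 L1 lnL by (simp add: y_def powr_powr powr_def \<delta>_def L_def)
    have x\<delta>: "x powr - \<delta> = L powr - 3"
      using x3 L1 by (simp add: powr_def \<delta>_def L_def[symmetric])
    have w12: "w powr 12 = L powr 2" by (simp add: w_def powr_powr)
    have "x powr - \<delta> * exp (6 * y powr \<delta> * K + 12) * w powr 12 = D * (L powr - 3 * L powr 2)"
      unfolding x\<delta> y\<delta> w12 D_def by (simp only: mult_ac)
    also have "\<dots> \<le> D * L powr (- (1 / 6))"
      unfolding powr_add[symmetric] using L1 D0 by (intro mult_left_mono powr_mono) auto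
    also have "\<dots> = D * (1 / w)" unfolding w_def powr_minus divide_inverse by simp
    finally have main: "x powr - \<delta> * exp (6 * y powr \<delta> * K + 12) * w powr 12 \<le> D * (1 / w)" .
    have "\<bar>empirical_distr f x t - limit_distr f t\<bar>
        \<le> 2 * alpha_fun f y + 4 / w + x powr - \<delta> * exp (6 * y powr \<delta> * K + 12) * w powr 12"
      unfolding K_def using x3 w1 y0 \<delta>0 XX w2
      by (intro empirical_distr_error_bound sm) auto
    also have "\<dots> \<le> 2 * alpha_fun f y + 4 / w + D * (1 / w)" using main by simp
    also have "\<dots> = 2 * alpha_fun f y + (4 + D) * (1 / w)" by (simp add: add_divide_distrib)
    also have "\<dots> \<le> C * alpha_fun f y + C * (1 / w)"
      using w1 C by (intro add_mono mult_right_mono alpha_nonneg sm) auto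
    finally show ?thesis by (simp add: y_def w_def L_def distrib_left)
  qed
  have small: "\<bar>empirical_distr f x t - limit_distr f t\<bar>
      \<le> C * (alpha_fun f (x powr (1 / ln (ln x))) + 1 / ln x powr (1 / 6))"
    if x: "x \<ge> 3" "x \<le> X'" for x t
  proof -
    have "empirical_distr f x t = partial_count (primes_upto (nat \<lceil>x\<rceil>)) x t / x"
      using x by (intro empirical_distr_eq_partial_count) auto
    then have "\<bar>empirical_distr f x t - limit_distr f t\<bar> \<le> 1"
      using partial_count_bounds[of x "primes_upto (nat \<lceil>x\<rceil>)" t] limit_distr_bounds[OF sm, of t] x
      unfolding abs_le_iff by linarith
    \<comment> \<open>On the bounded range the difference of two values in [0, 1] is at most 1, and
      \<open>ln x\<close> is positive and at most \<open>ln X'\<close>.\<close>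
    also have "1 \<le> ln X' powr (1 / 6) * (1 / ln x powr (1 / 6))"
      using x ln3[OF x(1)] by (simp add: le_divide_eq powr_mono2)
    also have "\<dots> \<le> C * (alpha_fun f (x powr (1 / ln (ln x))) + 1 / ln x powr (1 / 6))"
      using alpha_nonneg[OF sm] C by (intro mult_mono) auto
    finally show ?thesis .
  qed
  show ?thesis
  proof (intro exI[of _ C] allI impI SUP_least)
    fix x t :: real assume x: "x \<ge> 3"
    have "\<bar>empirical_distr f x t - limit_distr f t\<bar>
      \<le> C * (alpha_fun f (x powr (1 / ln (ln x))) + 1 / ln x powr (1 / 6))"
      using large[of x t] small[of x t] x by linarith
    \<comment> \<open>A value of \<open>powr\<close> is nonnegative for every base, so the sign of
      \<open>beta_fun\<close> does not matter here.\<close>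
    also have "\<dots> \<le> C * (alpha_fun f (x powr (1 / ln (ln x)))
        + beta_fun f (sqrt x) powr (1 / 4) + 1 / ln x powr (1 / 6))"
      using C by (intro mult_left_mono) auto
    finally show "ereal \<bar>empirical_distr f x t - limit_distr f t\<bar>
      \<le> ereal (C * (alpha_fun f (x powr (1 / ln (ln x)))
        + beta_fun f (sqrt x) powr (1 / 4) + 1 / ln x powr (1 / 6)))" by simp
  qed
qed

end
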